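(* Let $A,B$ be compact convex subsets of $\mathbb{R}^d$. Then the set $$\Sigma_{A,B}:=\{(x-y,\xi)\in\mathbb{R}^d\times S^{d-1}:\ \xi\in\mathrm{nor}(A,x)\cap\mathrm{nor}(B,y)\}$$ (where $x$ ranges over $\partial A$ and $y$ over $\partial B$), regarded as a subset of $\mathbb{R}^{2d}$, has finite $(d-1)$-content.
   Context: For a convex set $K\subset\mathbb{R}^d$ and $x\in\partial K$, $\mathrm{nor}(K,x)$ is the set of all unit outer normal vectors to $K$ at $x$ (unit vectors in the dual cone to the tangent cone of $K$ at $x$). For $S\subset\mathbb{R}^n$, $\mathcal{M}^{*m}(S)=\limsup_{\varepsilon\downarrow0}(2\varepsilon)^{m-n}\operatorname{Vol}(S_\varepsilon)$, where $S_\varepsilon$ is the set of points within distance $\varepsilon$ of $S$; $S$ has finite $m$-content if $\mathcal{M}^{*m}(S)<\infty$. *)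

theory Defs
  imports "HOL-Analysis.Analysis"
begin

definition tangent_cone :: "'a::euclidean_space set \<Rightarrow> 'a \<Rightarrow> 'a set" where
  "tangent_cone K x = closure (cone hull ((\<lambda>y. y - x) ` K))"

(* Sign convention: outer normals form the dual cone in the sense
   "nonpositive against every element". *)
definition dual_cone :: "'a::euclidean_space set \<Rightarrow> 'a set" where
  "dual_cone T = {\<xi>. \<forall>v\<in>T. \<xi> \<bullet> v \<le> 0}"

(* Intended for convex K and x in the frontier of K. *)
definition nor :: "'a::euclidean_space set \<Rightarrow> 'a \<Rightarrow> 'a set" where
  "nor K x = dual_cone (tangent_cone K x) \<inter> sphere 0 1"

(* The guard is needed because infdist x {} = 0, whereas no point is within
   a finite distance of the empty set. *)
definition parallel_set :: "'a::euclidean_space set \<Rightarrow> real \<Rightarrow> 'a set" where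
  "parallel_set S \<epsilon> = {x. S \<noteq> {} \<and> infdist x S \<le> \<epsilon>}"

definition upper_content :: "nat \<Rightarrow> 'a::euclidean_space set \<Rightarrow> ennreal" where
  "upper_content m S = Limsup (at_right 0)
     (\<lambda>\<epsilon>. ennreal ((2 * \<epsilon>) powr (real m - real DIM('a))) * emeasure lebesgue (parallel_set S \<epsilon>))"

definition finite_content :: "nat \<Rightarrow> 'a::euclidean_space set \<Rightarrow> bool" where
  "finite_content m S \<longleftrightarrow> upper_content m S < \<infinity>"

(* The Euclidean space of dimension 2d is the product type, whose norm is the
   Euclidean one. The topological boundary is taken in the whole space, so
   frontier A = A for a compact A with empty interior. *)
definition Sigma_nor ::
  "(real ^ 'd) set \<Rightarrow> (real ^ 'd) set \<Rightarrow> ((real ^ 'd) \<times> (real ^ 'd)) set" where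
  "Sigma_nor A B =
     {(x - y, \<xi>) | x y \<xi>. x \<in> frontier A \<and> y \<in> frontier B \<and> \<xi> \<in> nor A x \<inter> nor B y}"

end

theory Submission imports Defs begin

text \<open>
  For a convex body \<open>K\<close>, a unit vector \<open>\<xi>\<close> and \<open>t \<ge> 0\<close> let the cap of height \<open>t\<close> in direction
  \<open>\<xi>\<close> be the part of \<open>K\<close> within \<open>t\<close> of its supporting hyperplane with normal \<open>\<xi>\<close>. For nonempty
  \<open>A\<close> and \<open>B\<close>, put
  \<open>K = A + B + U\<close> with the closed unit ball \<open>U\<close>, let \<open>d\<close> be the dimension, and work at scale
  \<open>\<epsilon>\<close> with caps of height \<open>h = \<epsilon>\<^sup>2\<close>.

  If \<open>x\<close> and \<open>y\<close> have the common normal \<open>\<eta>\<close>, then \<open>x + y + \<eta>\<close> lies on the supporting hyperplane of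
  \<open>K\<close> with normal \<open>\<eta>\<close>. Suppose that the cap of \<open>K\<close> of height \<open>h\<close> in direction \<open>\<eta>\<close> is contained in
  the cap of height \<open>t = 6 d h\<close> in direction \<open>\<xi>\<close>. Deficits from the supporting hyperplanes add up
  over \<open>A + B + U\<close>, so \<open>x\<close>, \<open>y\<close> and \<open>\<eta>\<close> lie separately in the caps of height \<open>t\<close>
  of \<open>A\<close>, \<open>B\<close> and \<open>U\<close>. The ball forces \<open>\<bar>\<xi> - \<eta>\<bar> = O(\<surd>h) = O(\<epsilon>)\<close>. Moreover
  \<open>x - y\<close> lies in a difference of caps of \<open>A\<close> and \<open>B\<close>, and this difference is contained in a
  translate of the difference body of a cap of \<open>A + B\<close>: write
  \<open>x - y = (x + y0) - (x0 + y) + (x0 - y0)\<close> with the top points \<open>x0\<close> and \<open>y0\<close> in direction \<open>\<xi>\<close>.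
  This replacement of differences by sums is where \<open>\<Sigma>\<close> is compared with the boundary of \<open>A + B\<close>.
  An additional displacement of length \<open>\<epsilon>\<close> is absorbed by the cap of \<open>U\<close>, which has width of order
  \<open>\<epsilon>\<close> orthogonally to \<open>\<xi>\<close>, and by \<open>O(1 / \<epsilon>)\<close> translates in direction \<open>\<xi>\<close>, where the cap is only
  of order \<open>\<epsilon>\<^sup>2\<close> thick (lemma \<open>difference_near_translated_cap_diff\<close>).

  It remains to choose few directions \<open>\<xi>\<close>. By the economic cap covering theorem
  (\<open>economic_cap_covering\<close>) finitely many \<open>\<xi>\<close> suffice such that the difference bodies of the
  corresponding caps have total volume \<open>O(h) = O(\<epsilon>\<^sup>2)\<close>. Each \<open>\<xi>\<close> contributes to the
  \<open>\<epsilon>\<close>-neighbourhood of \<open>\<Sigma>\<close> at most \<open>O(1 / \<epsilon>)\<close> translates of its difference body times a ball of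
  radius \<open>O(\<epsilon>)\<close>. Hence this neighbourhood has volume
  \<open>O(\<epsilon>\<^sup>2 \<cdot> \<epsilon>\<^sup>-\<^sup>1 \<cdot> \<epsilon>\<^sup>d) = O(\<epsilon>\<^sup>d\<^sup>+\<^sup>1)\<close>, and \<open>d + 1 = 2 d - (d - 1)\<close>.

  The covering theorem is proved with a maximal family of disjoint Macbeath regions centred in the
  caps. They lie within \<open>2 h\<close> of supporting hyperplanes, hence in a shell of volume \<open>O(h)\<close>
  (\<open>measure_union_of_caps_le\<close>); each of them is as large as the difference body of its cap up to a
  factor (\<open>measure_cap_diff_le\<close>), provided that the centre is chosen well
  (\<open>central_exists\<close>); and if two of them meet, then each cap is contained in an enlargement of the
  other (\<open>cap_subset_cap_of_macbeath_meet\<close>).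
\<close>

section \<open>Centres of convex bodies\<close>

lemma real_DIM_ge_1: "real DIM('a::euclidean_space) \<ge> 1"
  using DIM_positive[where 'a='a] by (simp add: Suc_leI del: DIM_positive)

text \<open>
  The reflection of \<open>C\<close> in the point, scaled by \<open>1 / d\<close>, stays in \<open>C\<close>. The centroid is such a
  point, but this property alone is what makes the Macbeath region there comparable with \<open>C\<close>.
\<close>

definition central :: "'a::euclidean_space set \<Rightarrow> 'a \<Rightarrow> bool" where
  "central C p \<longleftrightarrow> p \<in> C \<and> (\<forall>v\<in>C. p + (1 / real DIM('a)) *\<^sub>R (p - v) \<in> C)"

text \<open>
  A point \<open>p\<close> is central iff it lies in each of the shrunken copies \<open>(x + d C) / (d + 1)\<close> of \<open>C\<close>,
  \<open>x \<in> C\<close>. Any \<open>d + 1\<close> of these copies share the average of their base points \<open>x\<close>, so Helly's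
  theorem and compactness give a point common to all of them.
\<close>

lemma central_exists:
  fixes C :: "'a::euclidean_space set"
  assumes "compact C" "convex C" "C \<noteq> {}"
  shows "\<exists>p. central C p"
proof -
  define d where "d = real DIM('a)"
  have d: "d \<ge> 1" using real_DIM_ge_1 by (simp add: d_def)
  define a where "a = 1 / (d + 1)"
  define b where "b = d / (d + 1)"
  have ab: "a > 0" "b > 0" "a + b = 1" "(1 / d) * b = a"
    using d by (auto simp: a_def b_def add_divide_distrib[symmetric])
  define H where "H x = (\<lambda>v. a *\<^sub>R x + b *\<^sub>R v) ` C" for x
  have H_convex: "convex (H x)" for x
    unfolding H_def by (rule convex_affinity[OF assms(2)])
  have H_compact: "compact (H x)" for x
    unfolding H_def by (rule compact_affinity[OF assms(1)])
  have average: "\<Inter>(H ` X) \<noteq> {}" if X: "finite X" "X \<noteq> {}" "X \<subseteq> C" "card X \<le> DIM('a) + 1" for X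
  proof -
    define k where "k = real (card X)"
    have k: "k > 0" "k \<le> d + 1" using X by (auto simp: k_def d_def card_gt_0_iff)
    have ak: "a \<le> 1 / k" unfolding a_def using k by (intro divide_left_mono) auto
    define p where "p = (\<Sum>y\<in>X. (1 / k) *\<^sub>R y)"
    have "p \<in> H x" if "x \<in> X" for x
    proof -
      (* barycentric coordinates of the point v of C with p = a x + b v *)
      define c where "c y = (1 / k - (if y = x then a else 0)) / b" for y
      have nonneg: "c y \<ge> 0" for y using k ak ab by (auto simp: c_def)
      have "sum c X = (k * (1 / k) - a) / b"
        using that X unfolding c_def sum_divide_distrib[symmetric] by (simp add: sum_subtractf k_def)
      also have "\<dots> = 1" using k ab by (simp add: divide_eq_eq)
      finally have "sum c X = 1" .
      then have in_C: "(\<Sum>y\<in>X. c y *\<^sub>R y) \<in> C"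
        using convex_sum[OF X(1) assms(2), of c "\<lambda>y. y"] nonneg X by (auto simp: subset_iff)
      have "b *\<^sub>R (\<Sum>y\<in>X. c y *\<^sub>R y) = (\<Sum>y\<in>X. (1 / k) *\<^sub>R y - (if y = x then a *\<^sub>R y else 0))"
        unfolding scaleR_sum_right using ab
        by (intro sum.cong) (auto simp: c_def scaleR_diff_left)
      also have "\<dots> = p - a *\<^sub>R x"
        using that X by (simp add: p_def sum_subtractf)
      finally have "p = a *\<^sub>R x + b *\<^sub>R (\<Sum>y\<in>X. c y *\<^sub>R y)" by simp
      then show ?thesis using in_C unfolding H_def by blast
    qed
    then show ?thesis by blast
  qed
  have "\<Inter>(H ` C) \<noteq> {}"
  proof (rule compact_fip_Heine_Borel)
    show "compact T" if "T \<in> H ` C" for T using that H_compact by auto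
    fix F assume F: "finite F" "F \<subseteq> H ` C"
    have small: "\<Inter>T \<noteq> {}" if T: "T \<subseteq> F" "card T \<le> DIM('a) + 1" "T \<noteq> {}" for T
    proof -
      have "T \<subseteq> H ` C" using T F by blast
      then obtain X where X: "X \<subseteq> C" "inj_on H X" "T = H ` X"
        by (auto simp: subset_image_inj)
      moreover have "finite T" using T F finite_subset by blast
      ultimately show ?thesis
        using average[of X] T by (auto simp: card_image finite_image_iff)
    qed
    show "\<Inter>F \<noteq> {}"
    proof (cases "card F \<ge> DIM('a) + 1")
      case True
      then show ?thesis
      proof (rule Helly)
        show "\<forall>s\<in>F. convex s" using F H_convex by auto
        show "\<Inter>T \<noteq> {}" if "T \<subseteq> F" "card T = DIM('a) + 1" for T
          using small[OF that(1)] that by force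
      qed
    next
      case False
      then show ?thesis using small[of F] by (cases "F = {}") auto
    qed
  qed
  then obtain p where p: "\<And>x. x \<in> C \<Longrightarrow> p \<in> H x" by auto
  have "central C p"
    unfolding central_def
  proof (intro conjI ballI)
    obtain x where x: "x \<in> C" using assms by auto
    then obtain v where "v \<in> C" "p = a *\<^sub>R x + b *\<^sub>R v" using p unfolding H_def by blast
    then show "p \<in> C" using convexD[OF assms(2) x, of v a b] ab by simp
  next
    fix x assume "x \<in> C"
    then obtain v where v: "v \<in> C" "p = a *\<^sub>R x + b *\<^sub>R v" using p unfolding H_def by blast
    have a: "a = 1 - b" using ab by simp
    then have "p - x = b *\<^sub>R (v - x)" by (simp add: v a algebra_simps)
    then have "(1 / d) *\<^sub>R (p - x) = a *\<^sub>R (v - x)" using ab(4) by simp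
    then have "p + (1 / d) *\<^sub>R (p - x) = (a + b) *\<^sub>R v" unfolding v(2) scaleR_left_distrib scaleR_diff_right by simp
    then show "p + (1 / real DIM('a)) *\<^sub>R (p - x) \<in> C" using v ab by (simp add: d_def)
  qed
  then show ?thesis by blast
qed

section \<open>Caps\<close>

text \<open>
  The height is measured without the support function: \<open>v\<close> falls short of no point of \<open>K\<close> by more
  than \<open>t\<close> in direction \<open>\<xi>\<close>. In particular, \<open>cap K \<xi> 0\<close> is the face of \<open>K\<close> in direction \<open>\<xi>\<close>.
\<close>

definition cap :: "'a::euclidean_space set \<Rightarrow> 'a \<Rightarrow> real \<Rightarrow> 'a set" where
  "cap K \<xi> t = {v\<in>K. \<forall>u\<in>K. \<xi> \<bullet> u \<le> \<xi> \<bullet> v + t}"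

lemma capD: "v \<in> cap K \<xi> t \<Longrightarrow> v \<in> K" "v \<in> cap K \<xi> t \<Longrightarrow> u \<in> K \<Longrightarrow> \<xi> \<bullet> u \<le> \<xi> \<bullet> v + t"
  by (auto simp: cap_def)

lemma cap_eq_halfspaces: "cap K \<xi> t = K \<inter> (\<Inter>u\<in>K. {v. \<xi> \<bullet> v \<ge> \<xi> \<bullet> u - t})"
  by (auto simp: cap_def algebra_simps)

lemma convex_cap: "convex K \<Longrightarrow> convex (cap K \<xi> t)"
  unfolding cap_eq_halfspaces by (intro convex_Int convex_INT) (auto simp: convex_halfspace_ge)

lemma compact_cap: "compact K \<Longrightarrow> compact (cap K \<xi> t)"
  unfolding cap_eq_halfspaces
  by (intro compact_Int_closed closed_INT) (auto simp: closed_halfspace_ge)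

lemma cap_mono: "s \<le> t \<Longrightarrow> cap K \<xi> s \<subseteq> cap K \<xi> t"
  by (force simp: cap_def)

lemma cap_top_nonempty:
  assumes "compact K" "K \<noteq> {}"
  shows "\<exists>w. w \<in> cap K \<xi> 0"
proof -
  have "continuous_on K (\<lambda>v. \<xi> \<bullet> v)" by (intro continuous_intros)
  from continuous_attains_sup[OF assms this] show ?thesis
    by (auto simp: cap_def)
qed

text \<open>
  A homothety centred at a point \<open>w\<close> of the supporting hyperplane scales all deficits by its ratio,
  so a cap of \<open>s\<close>-fold height fits into the \<open>s\<close>-fold enlargement of the cap from \<open>w\<close>.
\<close>

lemma cap_shrink:
  assumes "convex K" "w \<in> cap K \<xi> 0" "v \<in> cap K \<xi> (s * t)" "s \<ge> 1"
  shows "w + (1 / s) *\<^sub>R (v - w) \<in> cap K \<xi> t"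
proof -
  have "(1 - 1 / s) *\<^sub>R w + (1 / s) *\<^sub>R v \<in> K"
    using assms by (intro convexD[OF assms(1)]) (auto dest: capD)
  moreover have "(1 - 1 / s) *\<^sub>R w + (1 / s) *\<^sub>R v = w + (1 / s) *\<^sub>R (v - w)"
    by (simp add: algebra_simps)
  moreover have "\<xi> \<bullet> u \<le> \<xi> \<bullet> (w + (1 / s) *\<^sub>R (v - w)) + t" if "u \<in> K" for u
  proof -
    have 1: "\<xi> \<bullet> u \<le> \<xi> \<bullet> w" using capD(2)[OF assms(2) that] by simp
    have "\<xi> \<bullet> w \<le> \<xi> \<bullet> v + s * t" using capD assms by blast
    then have "(1 / s) * (\<xi> \<bullet> w) \<le> (1 / s) * (\<xi> \<bullet> v + s * t)"
      using assms by (intro mult_left_mono) auto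
    then have "(1 / s) * (\<xi> \<bullet> w) \<le> (1 / s) * (\<xi> \<bullet> v) + t"
      using assms by (simp add: distrib_left)
    then show ?thesis using 1 by (simp add: inner_simps algebra_simps)
  qed
  ultimately show ?thesis by (simp add: cap_def)
qed

section \<open>Macbeath regions\<close>

text \<open>
  This is \<open>p + 1/2 ((K - p) \<inter> (p - K))\<close>, the usual Macbeath region at \<open>p\<close> shrunk by \<open>1/2\<close>
  towards \<open>p\<close>. The factor is what makes \<open>macbeath_engulfing\<close> work.
\<close>

definition macbeath :: "'a::euclidean_space set \<Rightarrow> 'a \<Rightarrow> 'a set" where
  "macbeath K p = {r. 2 *\<^sub>R r - p \<in> K \<and> 3 *\<^sub>R p - 2 *\<^sub>R r \<in> K}"

lemma macbeath_eq_Int_images: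
  "macbeath K p = (\<lambda>v. (1/2) *\<^sub>R p + (1/2) *\<^sub>R v) ` K \<inter> (\<lambda>v. (3/2) *\<^sub>R p + (- 1/2) *\<^sub>R v) ` K"
proof (intro equalityI subsetI)
  fix r assume r: "r \<in> macbeath K p"
  have "r = (1/2) *\<^sub>R p + (1/2) *\<^sub>R (2 *\<^sub>R r - p)" "r = (3/2) *\<^sub>R p + (- 1/2) *\<^sub>R (3 *\<^sub>R p - 2 *\<^sub>R r)"
    by - ((rule euclidean_eqI, simp add: inner_add_left inner_diff_left field_simps)+)
  then show "r \<in> (\<lambda>v. (1/2) *\<^sub>R p + (1/2) *\<^sub>R v) ` K \<inter> (\<lambda>v. (3/2) *\<^sub>R p + (- 1/2) *\<^sub>R v) ` K"
    using r unfolding macbeath_def by blast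
next
  fix r assume "r \<in> (\<lambda>v. (1/2) *\<^sub>R p + (1/2) *\<^sub>R v) ` K \<inter> (\<lambda>v. (3/2) *\<^sub>R p + (- 1/2) *\<^sub>R v) ` K"
  then obtain v v' where v: "v \<in> K" "v' \<in> K" "r = (1/2) *\<^sub>R p + (1/2) *\<^sub>R v" "r = (3/2) *\<^sub>R p + (- 1/2) *\<^sub>R v'"
    by blast
  have "2 *\<^sub>R r - p = v" unfolding v(3) by (rule euclidean_eqI, simp add: inner_add_left inner_diff_left field_simps)
  moreover have "3 *\<^sub>R p - 2 *\<^sub>R r = v'" unfolding v(4) by (rule euclidean_eqI, simp add: inner_add_left inner_diff_left field_simps)
  ultimately show "r \<in> macbeath K p" using v by (simp add: macbeath_def)
qed

lemma compact_macbeath: "compact K \<Longrightarrow> compact (macbeath K p)"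
  unfolding macbeath_eq_Int_images by (intro compact_Int compact_affinity)

lemma center_in_macbeath: "p \<in> K \<Longrightarrow> p \<in> macbeath K p"
proof -
  have "2 *\<^sub>R p - p = p" "3 *\<^sub>R p - 2 *\<^sub>R p = p"
    by - ((rule euclidean_eqI, simp add: inner_add_left inner_diff_left field_simps)+)
  then show "p \<in> K \<Longrightarrow> p \<in> macbeath K p" by (simp add: macbeath_def)
qed

text \<open>
  Symmetry about \<open>p\<close>: no point of \<open>K\<close> is more than \<open>h\<close> above \<open>p\<close>, so none of the region is more
  than \<open>h\<close> below \<open>p\<close>.
\<close>

lemma macbeath_subset_cap:
  assumes "convex K" "p \<in> cap K \<xi> h"
  shows "macbeath K p \<subseteq> cap K \<xi> (2 * h)"
proof
  fix r assume r: "r \<in> macbeath K p"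
  then have a: "2 *\<^sub>R r - p \<in> K" "3 *\<^sub>R p - 2 *\<^sub>R r \<in> K" by (auto simp: macbeath_def)
  have p: "p \<in> K" using assms by (auto dest: capD)
  have "(1/2) *\<^sub>R p + (1/2) *\<^sub>R (2 *\<^sub>R r - p) \<in> K"
    by (rule convexD[OF assms(1) p a(1)]) auto
  moreover have "(1/2) *\<^sub>R p + (1/2) *\<^sub>R (2 *\<^sub>R r - p) = r"
    by (rule euclidean_eqI, simp add: inner_add_left inner_diff_left field_simps)
  ultimately have "r \<in> K" by simp
  moreover have "\<xi> \<bullet> u \<le> \<xi> \<bullet> r + 2 * h" if "u \<in> K" for u
    using capD(2)[OF assms(2) that] capD(2)[OF assms(2) p] capD(2)[OF assms(2) a(2)]
    by (simp add: inner_simps)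
  ultimately show "r \<in> cap K \<xi> (2 * h)" by (simp add: cap_def)
qed

text \<open>
  The engulfing property of Macbeath regions. The assumptions on \<open>v\<close> put it into the full region
  at \<open>q\<close>; the conclusion bounds how far \<open>v\<close> can be from \<open>p\<close>, measured by \<open>K\<close> seen from \<open>p\<close> in the
  opposite direction. The point claimed to be in \<open>K\<close> is a convex combination of three reflected
  points known to be in \<open>K\<close>, with weights \<open>1/5\<close>, \<open>2/5\<close> and \<open>2/5\<close>.
\<close>

lemma macbeath_engulfing:
  assumes K: "convex K" and p: "p \<in> K"
    and r: "r \<in> macbeath K p" "r \<in> macbeath K q"
    and v: "v \<in> K" "2 *\<^sub>R q - v \<in> K"
  shows "p - (1/5) *\<^sub>R (v - p) \<in> K"
proof -
  have s: "2 *\<^sub>R r - q \<in> K" "3 *\<^sub>R p - 2 *\<^sub>R r \<in> K" using r by (auto simp: macbeath_def)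
  have "(1/2) *\<^sub>R (2 *\<^sub>R r - q) + (1/2) *\<^sub>R (3 *\<^sub>R p - 2 *\<^sub>R r) \<in> K"
    by (rule convexD[OF K s]) auto
  then have "(1/5) *\<^sub>R (2 *\<^sub>R q - v) + (4/5) *\<^sub>R ((1/2) *\<^sub>R (2 *\<^sub>R r - q) + (1/2) *\<^sub>R (3 *\<^sub>R p - 2 *\<^sub>R r)) \<in> K"
    by (intro convexD[OF K v(2)]) auto
  also have "(1/5) *\<^sub>R (2 *\<^sub>R q - v) + (4/5) *\<^sub>R ((1/2) *\<^sub>R (2 *\<^sub>R r - q) + (1/2) *\<^sub>R (3 *\<^sub>R p - 2 *\<^sub>R r))
      = p - (1/5) *\<^sub>R (v - p)"
    by (rule euclidean_eqI, simp add: inner_add_left inner_diff_left field_simps)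
  finally show ?thesis .
qed

lemma central_towards:
  fixes C :: "'a::euclidean_space set"
  assumes "convex C" "central C p" "v \<in> C"
  shows "p + (1 / real DIM('a)) *\<^sub>R (v - p) \<in> C"
proof -
  have "(1 - 1 / real DIM('a)) *\<^sub>R p + (1 / real DIM('a)) *\<^sub>R v \<in> C"
    using real_DIM_ge_1[where 'a='a] assms
    by (intro convexD[OF assms(1)]) (auto simp: central_def)
  then show ?thesis by (simp add: algebra_simps)
qed

text \<open>
  A point \<open>v\<close> of the second cap, contracted by \<open>1 / d\<close> towards the central point \<open>q\<close>, lies in the
  full Macbeath region at \<open>q\<close>. By engulfing, its deficit in direction \<open>\<xi>\<close> is at most \<open>5 h\<close> plus
  that of \<open>p\<close>, hence at most \<open>6 h\<close>; undoing the contraction costs the factor \<open>d\<close>, since \<open>q\<close> itself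
  has a nonnegative deficit.
\<close>

lemma cap_subset_cap_of_macbeath_meet:
  fixes K :: "'a::euclidean_space set"
  assumes K: "compact K" "convex K"
    and p: "central (cap K \<xi> h) p" and q: "central (cap K \<eta> h) q"
    and meet: "macbeath K p \<inter> macbeath K q \<noteq> {}"
  shows "cap K \<eta> h \<subseteq> cap K \<xi> (6 * real DIM('a) * h)"
proof
  define d where "d = real DIM('a)"
  have d: "d \<ge> 1" using real_DIM_ge_1 by (simp add: d_def)
  fix v assume v: "v \<in> cap K \<eta> h"
  have pc: "p \<in> cap K \<xi> h" and pK: "p \<in> K" and qK: "q \<in> K" using p q by (auto simp: central_def dest: capD)
  define v' where "v' = q + (1 / d) *\<^sub>R (v - q)"
  have v'K: "v' \<in> K"
    using central_towards[OF convex_cap[OF K(2)] q v] by (auto simp: v'_def d_def dest: capD)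
  have "q + (1 / d) *\<^sub>R (q - v) \<in> cap K \<eta> h"
    using q v by (simp add: central_def d_def)
  also have "q + (1 / d) *\<^sub>R (q - v) = 2 *\<^sub>R q - v'"
    by (simp add: v'_def scaleR_2 algebra_simps)
  finally have "2 *\<^sub>R q - v' \<in> K" by (auto dest: capD)
  moreover obtain r where "r \<in> macbeath K p" "r \<in> macbeath K q" using meet by blast
  ultimately have "p - (1/5) *\<^sub>R (v' - p) \<in> K"
    using macbeath_engulfing[OF K(2) pK _ _ v'K] by blast
  from capD(2)[OF pc this] have pv': "\<xi> \<bullet> p \<le> \<xi> \<bullet> v' + 5 * h"
    by (simp add: inner_simps divide_simps)
  obtain w where w: "w \<in> cap K \<xi> 0" using cap_top_nonempty K pK by blast
  then have wK: "w \<in> K" by (auto dest: capD)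
  have "\<xi> \<bullet> w \<le> \<xi> \<bullet> v' + 6 * h" using capD(2)[OF pc wK] pv' by simp
  then have "d * (\<xi> \<bullet> w) \<le> d * (\<xi> \<bullet> v' + 6 * h)" using d by (intro mult_left_mono) auto
  also have "\<dots> = (d - 1) * (\<xi> \<bullet> q) + \<xi> \<bullet> v + 6 * d * h"
    using d by (simp add: v'_def inner_simps algebra_simps)
  also have "\<dots> \<le> (d - 1) * (\<xi> \<bullet> w) + \<xi> \<bullet> v + 6 * d * h"
    using d capD(2)[OF w qK] by (intro add_right_mono mult_left_mono) auto
  finally have "\<xi> \<bullet> w \<le> \<xi> \<bullet> v + 6 * d * h" by (simp add: algebra_simps)
  then have "\<xi> \<bullet> u \<le> \<xi> \<bullet> v + 6 * d * h" if "u \<in> K" for u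
    using capD(2)[OF w that] by simp
  then show "v \<in> cap K \<xi> (6 * real DIM('a) * h)" using v by (auto simp: cap_def d_def)
qed

section \<open>Volume estimates\<close>

definition cap_diff :: "'a::euclidean_space set \<Rightarrow> 'a \<Rightarrow> real \<Rightarrow> 'a set" where
  "cap_diff K \<xi> t = {a - b | a b. a \<in> cap K \<xi> t \<and> b \<in> cap K \<xi> t}"

lemma compact_cap_diff: "compact K \<Longrightarrow> compact (cap_diff K \<xi> t)"
  unfolding cap_diff_def by (intro compact_differences compact_cap)

text \<open>
  This is where centrality is used: around a central point of a cap, the symmetric Macbeath region
  contains a fixed fraction of the difference body of the cap. The factor \<open>s\<close> is the cost of
  passing from height \<open>s h\<close> to \<open>h\<close>, the factor \<open>d\<close> comes from centrality, and the factor \<open>4\<close> from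
  the half-size region and from averaging two points.
\<close>

lemma cap_diff_subset_macbeath:
  fixes K :: "'a::euclidean_space set"
  assumes K: "compact K" "convex K"
    and p: "central (cap K \<xi> h) p" and s: "s \<ge> 1"
  defines "m \<equiv> 4 * real DIM('a) * s"
  shows "cap_diff K \<xi> (s * h) \<subseteq> (\<lambda>r. m *\<^sub>R r + - (m *\<^sub>R p)) ` macbeath K p"
proof
  define d where "d = real DIM('a)"
  have d: "d \<ge> 1" using real_DIM_ge_1 by (simp add: d_def)
  fix z assume "z \<in> cap_diff K \<xi> (s * h)"
  then obtain a b where ab: "a \<in> cap K \<xi> (s * h)" "b \<in> cap K \<xi> (s * h)" "z = a - b"
    by (auto simp: cap_diff_def)
  have pK: "p \<in> K" using p by (auto simp: central_def dest: capD)
  obtain w where w: "w \<in> cap K \<xi> 0" using cap_top_nonempty K pK by blast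
  define a' where "a' = w + (1 / s) *\<^sub>R (a - w)"
  define b' where "b' = w + (1 / s) *\<^sub>R (b - w)"
  have ab': "a' \<in> cap K \<xi> h" "b' \<in> cap K \<xi> h"
    unfolding a'_def b'_def by (intro cap_shrink[OF K(2) w _ s] ab)+
  define e where "e = 1 / (2 * d)"
  have e: "(1/2) * (1 / d) = e" "m * (e / 2) = s" using d by (auto simp: e_def m_def d_def)
  define r where "r = p + (e / 2) *\<^sub>R (a' - b')"
  have in_K: "p + e *\<^sub>R (x - y) \<in> K" if "x \<in> cap K \<xi> h" "y \<in> cap K \<xi> h" for x y
  proof -
    have "p + (1 / d) *\<^sub>R (x - p) \<in> K" "p + (1 / d) *\<^sub>R (p - y) \<in> K"
      using central_towards[OF convex_cap[OF K(2)] p that(1)] p that(2)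
      by (auto simp: d_def central_def dest: capD)
    then have "(1/2) *\<^sub>R (p + (1 / d) *\<^sub>R (x - p)) + (1/2) *\<^sub>R (p + (1 / d) *\<^sub>R (p - y)) \<in> K"
      by (intro convexD[OF K(2)]) auto
    also have "(1/2) *\<^sub>R (p + (1 / d) *\<^sub>R (x - p)) + (1/2) *\<^sub>R (p + (1 / d) *\<^sub>R (p - y))
       = ((1/2) *\<^sub>R p + (1/2) *\<^sub>R p) + ((1/2) * (1 / d)) *\<^sub>R ((x - p) + (p - y))"
      unfolding scaleR_add_right scaleR_scaleR by (simp only: ac_simps)
    also have "\<dots> = p + e *\<^sub>R (x - y)"
      unfolding e(1) by (simp add: scaleR_left_distrib[symmetric])
    finally show ?thesis .
  qed
  have "2 *\<^sub>R r - p = p + e *\<^sub>R (a' - b')" "3 *\<^sub>R p - 2 *\<^sub>R r = p + e *\<^sub>R (b' - a')"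
    unfolding r_def
    by - ((rule euclidean_eqI, simp add: inner_add_left inner_diff_left field_simps)+)
  then have "r \<in> macbeath K p" using in_K ab' by (simp add: macbeath_def)
  moreover have "z = s *\<^sub>R (a' - b')"
    using s by (simp add: ab a'_def b'_def scaleR_diff_right[symmetric])
  then have "z = m *\<^sub>R r + - (m *\<^sub>R p)"
    using e(2) by (simp add: r_def scaleR_add_right)
  ultimately show "z \<in> (\<lambda>r. m *\<^sub>R r + - (m *\<^sub>R p)) ` macbeath K p" by blast
qed

lemma measure_cap_diff_le:
  fixes K :: "'a::euclidean_space set"
  assumes "compact K" "convex K" "central (cap K \<xi> h) p" "s \<ge> 1"
  shows "measure lebesgue (cap_diff K \<xi> (s * h))
       \<le> (4 * real DIM('a) * s) ^ DIM('a) * measure lebesgue (macbeath K p)"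
proof -
  define m where "m = 4 * real DIM('a) * s"
  have "(\<lambda>r. m *\<^sub>R r + - (m *\<^sub>R p)) ` macbeath K p \<in> lmeasurable"
    using compact_affinity[OF compact_macbeath[OF assms(1)], of "- (m *\<^sub>R p)" m p]
    by (intro lmeasurable_compact) (simp add: add.commute)
  then have "measure lebesgue (cap_diff K \<xi> (s * h)) \<le> measure lebesgue ((\<lambda>r. m *\<^sub>R r + - (m *\<^sub>R p)) ` macbeath K p)"
    using cap_diff_subset_macbeath[OF assms] lmeasurable_compact[OF compact_cap_diff[OF assms(1)]]
    by (intro measure_mono_fmeasurable) (auto simp: m_def)
  also have "\<dots> = \<bar>m\<bar> ^ DIM('a) * measure lebesgue (macbeath K p)"
    by (rule measure_lebesgue_affine)
  finally show ?thesis using assms(4) by (simp add: m_def abs_mult)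
qed

text \<open>
  A crude lower bound that depends on \<open>h\<close> but not on \<open>\<xi>\<close>. It serves to bound the number of
  disjoint Macbeath regions. Every cap of height \<open>h\<close> contains a copy of \<open>K\<close>, shrunk by the factor
  \<open>h / (2 R + h)\<close> towards a top point \<open>w\<close>.
\<close>

lemma measure_macbeath_ge:
  fixes K :: "'a::euclidean_space set"
  assumes K: "compact K" "convex K" and p: "central (cap K \<xi> h) p"
    and \<xi>: "norm \<xi> = 1" and R: "\<And>v. v \<in> K \<Longrightarrow> norm v \<le> R" and h: "h > 0"
  shows "(4 * real DIM('a)) ^ DIM('a) * measure lebesgue (macbeath K p)
      \<ge> (h / (2 * R + h)) ^ DIM('a) * measure lebesgue K"
proof -
  have pK: "p \<in> K" using p by (auto simp: central_def dest: capD)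
  obtain w where w: "w \<in> cap K \<xi> 0" using cap_top_nonempty K pK by blast
  have wK: "w \<in> K" using w by (rule capD)
  have R0: "R \<ge> 0" using R[OF pK] norm_ge_zero order_trans by blast
  define c where "c = h / (2 * R + h)"
  have c: "c > 0" "c \<le> 1" "c * (2 * R) \<le> h"
    using h R0 by (auto simp: c_def field_simps)
  have "(\<lambda>v. c *\<^sub>R v + - (c *\<^sub>R w)) ` K \<subseteq> cap_diff K \<xi> h"
  proof
    fix z assume "z \<in> (\<lambda>v. c *\<^sub>R v + - (c *\<^sub>R w)) ` K"
    then obtain v where v: "v \<in> K" "z = c *\<^sub>R v - c *\<^sub>R w" by auto
    have "(1 - c) *\<^sub>R w + c *\<^sub>R v \<in> K" using c by (intro convexD[OF K(2) wK v(1)]) auto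
    then have "w + z \<in> K" by (simp add: v algebra_simps)
    moreover have "\<xi> \<bullet> u \<le> \<xi> \<bullet> (w + z) + h" if "u \<in> K" for u
    proof -
      have "\<xi> \<bullet> (w - v) \<le> norm (w - v)" using norm_cauchy_schwarz[of \<xi> "w - v"] \<xi> by simp
      also have "\<dots> \<le> 2 * R" using norm_triangle_ineq4[of w v] R[OF wK] R[OF v(1)] by simp
      finally have "c * (\<xi> \<bullet> (w - v)) \<le> c * (2 * R)" using c by (intro mult_left_mono) auto
      then have "\<xi> \<bullet> z \<ge> - h" using c by (simp add: v inner_simps algebra_simps)
      then show ?thesis using capD(2)[OF w that] by (simp add: inner_simps)
    qed
    ultimately have "w + z \<in> cap K \<xi> h" by (simp add: cap_def)
    moreover have "w \<in> cap K \<xi> h" using w cap_mono[of 0 h K \<xi>] h by auto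
    ultimately show "z \<in> cap_diff K \<xi> h"
      unfolding cap_diff_def by (metis (mono_tags, lifting) add_diff_cancel_left' mem_Collect_eq)
  qed
  moreover have "(\<lambda>v. c *\<^sub>R v + - (c *\<^sub>R w)) ` K \<in> lmeasurable"
    using compact_affinity[OF K(1), of "- (c *\<^sub>R w)" c] by (intro lmeasurable_compact) (simp add: add.commute)
  ultimately have "measure lebesgue ((\<lambda>v. c *\<^sub>R v + - (c *\<^sub>R w)) ` K) \<le> measure lebesgue (cap_diff K \<xi> h)"
    using lmeasurable_compact[OF compact_cap_diff[OF K(1)]] by (intro measure_mono_fmeasurable) auto
  also have "measure lebesgue ((\<lambda>v. c *\<^sub>R v + - (c *\<^sub>R w)) ` K) = \<bar>c\<bar> ^ DIM('a) * measure lebesgue K"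
    by (rule measure_lebesgue_affine)
  also have "measure lebesgue (cap_diff K \<xi> h) \<le> (4 * real DIM('a)) ^ DIM('a) * measure lebesgue (macbeath K p)"
    using measure_cap_diff_le[OF K p, of 1] by simp
  finally show ?thesis using c(1) unfolding c_def[symmetric] by simp
qed

text \<open>
  Shrinking \<open>K\<close> by the factor \<open>1 - 3 h\<close> towards the centre \<open>c\<close> of a contained unit ball moves it
  away from every supporting hyperplane by at least \<open>3 h\<close>, so all caps of height \<open>2 h\<close> avoid the
  shrunken copy. Bernoulli's inequality bounds the volume of what is left.
\<close>

lemma measure_union_of_caps_le:
  fixes K :: "'a::euclidean_space set"
  assumes K: "compact K" "convex K" and ball: "cball c 1 \<subseteq> K" and h: "0 < h" "3 * h \<le> 1"
    and S: "S \<in> sets lebesgue" "S \<subseteq> (\<Union>\<xi>\<in>sphere 0 1. cap K \<xi> (2 * h))"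
  shows "measure lebesgue S \<le> 3 * real DIM('a) * h * measure lebesgue K"
proof -
  define T where "T = (\<lambda>v. (1 - 3 * h) *\<^sub>R v + (3 * h) *\<^sub>R c) ` K"
  have cK: "c \<in> K" using ball by auto
  have "T \<subseteq> K" unfolding T_def using h cK by (auto intro!: convexD[OF K(2)])
  have "compact T" using compact_affinity[OF K(1), of "(3 * h) *\<^sub>R c" "1 - 3 * h"]
    by (simp add: T_def add.commute)
  have "S \<subseteq> K - T"
  proof
    fix r assume "r \<in> S"
    then obtain \<xi> where \<xi>: "norm \<xi> = 1" "r \<in> cap K \<xi> (2 * h)" using S by auto
    have "r \<notin> T"
    proof
      assume "r \<in> T"
      then obtain v where v: "v \<in> K" "r = (1 - 3 * h) *\<^sub>R v + (3 * h) *\<^sub>R c" by (auto simp: T_def)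
      have "c + \<xi> \<in> K" using ball \<xi> by (auto simp: subset_iff dist_norm)
      from capD(2)[OF \<xi>(2) this] have 1: "\<xi> \<bullet> c + 1 \<le> \<xi> \<bullet> r + 2 * h"
        using \<xi>(1) by (simp add: inner_simps norm_eq_1)
      have 2: "\<xi> \<bullet> v \<le> \<xi> \<bullet> r + 2 * h" by (rule capD(2)[OF \<xi>(2) v(1)])
      have "(1 - 3 * h) * (\<xi> \<bullet> v) + (3 * h) * (\<xi> \<bullet> c + 1) \<le> (1 - 3 * h) * (\<xi> \<bullet> r + 2 * h) + (3 * h) * (\<xi> \<bullet> r + 2 * h)"
        using h by (intro add_mono mult_left_mono[OF 1] mult_left_mono[OF 2]) auto
      also have "\<dots> = \<xi> \<bullet> r + 2 * h" by (simp add: algebra_simps)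
      also have "\<xi> \<bullet> r = (1 - 3 * h) * (\<xi> \<bullet> v) + (3 * h) * (\<xi> \<bullet> c)"
        by (simp add: v inner_simps)
      finally have "(1 - 3 * h) * (\<xi> \<bullet> v) + 3 * h * (\<xi> \<bullet> c) + 3 * h
        \<le> (1 - 3 * h) * (\<xi> \<bullet> v) + 3 * h * (\<xi> \<bullet> c) + 2 * h"
        by (simp only: distrib_left mult_1_right add.assoc)
      then show False using h by simp
    qed
    then show "r \<in> K - T" using \<xi> by (auto dest: capD)
  qed
  then have "measure lebesgue S \<le> measure lebesgue (K - T)"
    using S(1) lmeasurable_compact[OF K(1)] lmeasurable_compact[OF \<open>compact T\<close>]
    by (intro measure_mono_fmeasurable) auto
  also have "\<dots> = measure lebesgue K - measure lebesgue T"
    using \<open>T \<subseteq> K\<close> lmeasurable_compact[OF K(1)] lmeasurable_compact[OF \<open>compact T\<close>]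
    by (intro measurable_measure_Diff) auto
  also have "measure lebesgue T = \<bar>1 - 3 * h\<bar> ^ DIM('a) * measure lebesgue K"
    unfolding T_def by (rule measure_lebesgue_affine)
  finally have "measure lebesgue S \<le> measure lebesgue K - \<bar>1 - 3 * h\<bar> ^ DIM('a) * measure lebesgue K" .
  moreover have "(1 - real DIM('a) * (3 * h)) * measure lebesgue K \<le> \<bar>1 - 3 * h\<bar> ^ DIM('a) * measure lebesgue K"
    using Bernoulli_inequality[of "- 3 * h" "DIM('a)"] h by (intro mult_right_mono) (auto simp: algebra_simps)
  ultimately show ?thesis by (simp add: algebra_simps)
qed

section \<open>Economic cap covering\<close>

text \<open>
  The caps of one fixed height \<open>h\<close> are covered by boundedly enlarged caps from a finite family whose
  difference bodies have a total volume of order \<open>h\<close>, the order of the volume of the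
  shell covered by the caps. The directions are chosen so that the Macbeath regions at central
  points of their caps form a disjoint family of maximal cardinality.
\<close>

theorem economic_cap_covering:
  fixes K :: "'a::euclidean_space set"
  assumes K: "compact K" "convex K" and ball: "cball c 1 \<subseteq> K" and h: "0 < h" "3 * h \<le> 1"
  obtains I where "finite I" "I \<subseteq> sphere 0 1"
    "\<And>\<eta>. norm \<eta> = 1 \<Longrightarrow> \<exists>\<xi>\<in>I. cap K \<eta> h \<subseteq> cap K \<xi> (6 * real DIM('a) * h)"
    "\<And>s. s \<ge> 1 \<Longrightarrow> (\<Sum>\<xi>\<in>I. measure lebesgue (cap_diff K \<xi> (s * h)))
       \<le> (4 * real DIM('a) * s) ^ DIM('a) * (3 * real DIM('a) * h * measure lebesgue K)"
proof -
  have cK: "c \<in> K" using ball by auto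
  have "\<exists>p. central (cap K \<xi> h) p" for \<xi>
  proof -
    obtain w where "w \<in> cap K \<xi> 0" using cap_top_nonempty K cK by blast
    then have "cap K \<xi> h \<noteq> {}" using cap_mono[of 0 h K \<xi>] h by auto
    then show ?thesis
      by (intro central_exists compact_cap convex_cap K)
  qed
  then obtain p where p: "\<And>\<xi>. central (cap K \<xi> h) (p \<xi>)" by metis
  define M where "M \<xi> = macbeath K (p \<xi>)" for \<xi>
  have pcap: "p \<xi> \<in> cap K \<xi> h" for \<xi> using p by (simp add: central_def)
  have pM: "p \<xi> \<in> M \<xi>" for \<xi> unfolding M_def by (intro center_in_macbeath capD(1)[OF pcap])
  have M_lmeas: "M \<xi> \<in> lmeasurable" for \<xi>
    unfolding M_def by (intro lmeasurable_compact compact_macbeath K)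
  define good where "good J \<longleftrightarrow> finite J \<and> J \<subseteq> sphere 0 1 \<and> disjoint_family_on M J" for J
  have sum_M: "(\<Sum>\<xi>\<in>J. measure lebesgue (M \<xi>)) \<le> 3 * real DIM('a) * h * measure lebesgue K"
    if J: "good J" for J
  proof -
    have "(\<Sum>\<xi>\<in>J. measure lebesgue (M \<xi>)) = measure lebesgue (\<Union>\<xi>\<in>J. M \<xi>)"
      using J M_lmeas by (intro measure_finite_Union[symmetric])
        (auto simp: good_def fmeasurableD fmeasurableD2 simp del: emeasure_completion)
    also have "\<dots> \<le> 3 * real DIM('a) * h * measure lebesgue K"
    proof (rule measure_union_of_caps_le[OF K ball h])
      show "(\<Union>\<xi>\<in>J. M \<xi>) \<in> sets lebesgue"
        using J M_lmeas by (intro sets.finite_UN) (auto simp: good_def)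
      show "(\<Union>\<xi>\<in>J. M \<xi>) \<subseteq> (\<Union>\<xi>\<in>sphere 0 1. cap K \<xi> (2 * h))"
        using J macbeath_subset_cap[OF K(2) pcap] unfolding good_def M_def by blast
    qed
    finally show ?thesis .
  qed
  obtain R where R: "\<And>v. v \<in> K \<Longrightarrow> norm v \<le> R"
    using compact_imp_bounded[OF K(1)] by (auto simp: bounded_iff)
  have R0: "R \<ge> 0" using R[OF cK] norm_ge_zero order_trans by blast
  define m where "m = (h / (2 * R + h)) ^ DIM('a) * measure lebesgue K / (4 * real DIM('a)) ^ DIM('a)"
  have "0 < measure lebesgue (cball c 1)" by simp
  also have "\<dots> \<le> measure lebesgue K"
    using ball lmeasurable_compact[OF K(1)] by (intro measure_mono_fmeasurable) auto
  finally have "m > 0" using h R0 by (auto simp: m_def intro!: divide_pos_pos mult_pos_pos)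
  have m: "m \<le> measure lebesgue (M \<xi>)" if "norm \<xi> = 1" for \<xi>
    using measure_macbeath_ge[OF K p that R h(1)] by (simp add: m_def M_def divide_le_eq mult.commute)
  define N where "N = nat \<lceil>3 * real DIM('a) * h * measure lebesgue K / m\<rceil>"
  have card_le: "card J \<le> N" if "good J" for J
  proof -
    have "real (card J) * m \<le> (\<Sum>\<xi>\<in>J. measure lebesgue (M \<xi>))"
      using m that by (intro sum_bounded_below) (auto simp: good_def)
    also note sum_M[OF that]
    finally have "real (card J) \<le> 3 * real DIM('a) * h * measure lebesgue K / m"
      using \<open>m > 0\<close> by (simp add: pos_le_divide_eq)
    then show ?thesis unfolding N_def by linarith
  qed
  have "good {}" by (simp add: good_def disjoint_family_on_def)
  then obtain I where I: "good I" "\<And>J. good J \<Longrightarrow> card J \<le> card I"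
    using ex_has_greatest_nat[of good "{}" card "Suc N"] card_le by (auto simp: less_Suc_eq_le)
  show ?thesis
  proof
    show "finite I" "I \<subseteq> sphere 0 1" using I(1) by (auto simp: good_def)
    show "\<exists>\<xi>\<in>I. cap K \<eta> h \<subseteq> cap K \<xi> (6 * real DIM('a) * h)" if \<eta>: "norm \<eta> = 1" for \<eta>
    proof -
      have "\<exists>\<xi>\<in>I. M \<xi> \<inter> M \<eta> \<noteq> {}"
      proof (rule ccontr)
        assume none: "\<not> ?thesis"
        then have "\<eta> \<notin> I" using pM by blast
        moreover have "good (insert \<eta> I)"
          using none I(1) \<eta> \<open>\<eta> \<notin> I\<close> by (auto simp: good_def disjoint_family_on_insert)
        ultimately show False
          using I(2)[of "insert \<eta> I"] I(1) by (simp add: good_def)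
      qed
      then show ?thesis
        using cap_subset_cap_of_macbeath_meet[OF K p p] unfolding M_def by blast
    qed
    show "(\<Sum>\<xi>\<in>I. measure lebesgue (cap_diff K \<xi> (s * h)))
       \<le> (4 * real DIM('a) * s) ^ DIM('a) * (3 * real DIM('a) * h * measure lebesgue K)" if s: "s \<ge> 1" for s
    proof -
      have "(\<Sum>\<xi>\<in>I. measure lebesgue (cap_diff K \<xi> (s * h)))
          \<le> (\<Sum>\<xi>\<in>I. (4 * real DIM('a) * s) ^ DIM('a) * measure lebesgue (M \<xi>))"
        unfolding M_def by (intro sum_mono measure_cap_diff_le K p s)
      also have "\<dots> \<le> (4 * real DIM('a) * s) ^ DIM('a) * (3 * real DIM('a) * h * measure lebesgue K)"
        unfolding sum_distrib_left[symmetric] using s by (intro mult_left_mono sum_M I) auto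
      finally show ?thesis .
    qed
  qed
qed

section \<open>Caps of the rounded sum\<close>

lemma nor_imp_cap:
  assumes "closed A" "x \<in> frontier A" "\<xi> \<in> nor A x"
  shows "x \<in> cap A \<xi> 0" "norm \<xi> = 1"
proof -
  have "u - x \<in> tangent_cone A x" if "u \<in> A" for u
    using that hull_subset[of "(\<lambda>y. y - x) ` A" cone] closure_subset
    unfolding tangent_cone_def by blast
  then have "\<xi> \<bullet> (u - x) \<le> 0" if "u \<in> A" for u
    using assms(3) that by (auto simp: nor_def dual_cone_def)
  moreover have "x \<in> A" using assms frontier_subset_closed by blast
  ultimately show "x \<in> cap A \<xi> 0" by (auto simp: cap_def inner_simps)
  show "norm \<xi> = 1" using assms by (simp add: nor_def)
qed

text \<open>
  The summand \<open>cball 0 1\<close> makes caps remember their direction up to an error of the order of the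
  square root of their height, and it puts a unit ball into the sum.
\<close>

definition rounded_sum :: "'a::euclidean_space set \<Rightarrow> 'a set \<Rightarrow> 'a set" where
  "rounded_sum A B = (\<lambda>(x, y, u). x + y + u) ` (A \<times> B \<times> cball 0 1)"

lemma compact_rounded_sum: "compact A \<Longrightarrow> compact B \<Longrightarrow> compact (rounded_sum A B)"
  unfolding rounded_sum_def
  by (intro compact_continuous_image compact_Times)
     (auto simp: case_prod_unfold intro!: continuous_intros)

lemma convex_rounded_sum: "convex A \<Longrightarrow> convex B \<Longrightarrow> convex (rounded_sum A B)"
  unfolding rounded_sum_def
  by (intro convex_linear_image convex_Times)
     (auto simp: linear_iff case_prod_unfold algebra_simps)

lemma cap_rounded_sumI:
  assumes "norm \<xi> = 1" "x \<in> cap A \<xi> a" "y \<in> cap B \<xi> b" "norm u \<le> 1" "\<xi> \<bullet> u \<ge> 1 - c"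
  shows "x + y + u \<in> cap (rounded_sum A B) \<xi> (a + b + c)"
proof -
  have "x + y + u \<in> rounded_sum A B"
    using assms unfolding rounded_sum_def by (force dest: capD)
  moreover have "\<xi> \<bullet> z \<le> \<xi> \<bullet> (x + y + u) + (a + b + c)" if zK: "z \<in> rounded_sum A B" for z
  proof -
    obtain x' y' u' where z: "z = x' + y' + u'" "x' \<in> A" "y' \<in> B" "norm u' \<le> 1"
      using zK by (auto simp: rounded_sum_def)
    have "\<xi> \<bullet> u' \<le> 1" using norm_cauchy_schwarz[of \<xi> u'] z assms(1) by simp
    then show ?thesis
      using capD(2)[OF assms(2) z(2)] capD(2)[OF assms(3) z(3)] assms(5) by (simp add: z inner_simps)
  qed
  ultimately show ?thesis by (simp add: cap_def)
qed

text \<open>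
  Deficits of the summands are nonnegative and add up to the deficit of the sum, so none of them
  exceeds it.
\<close>

lemma cap_rounded_sumD:
  assumes "norm \<xi> = 1" "x \<in> A" "y \<in> B" "norm u \<le> 1" "x + y + u \<in> cap (rounded_sum A B) \<xi> t"
  shows "x \<in> cap A \<xi> t" "y \<in> cap B \<xi> t" "\<xi> \<bullet> u \<ge> 1 - t"
proof -
  have *: "\<xi> \<bullet> (x' + y' + u') \<le> \<xi> \<bullet> (x + y + u) + t" if "x' \<in> A" "y' \<in> B" "norm u' \<le> 1" for x' y' u'
    by (rule capD(2)[OF assms(5)]) (use that in \<open>force simp: rounded_sum_def\<close>)
  show "x \<in> cap A \<xi> t" using *[OF _ assms(3,4)] assms(2) by (auto simp: cap_def inner_simps)
  show "y \<in> cap B \<xi> t" using *[OF assms(2) _ assms(4)] assms(3) by (auto simp: cap_def inner_simps)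
  show "\<xi> \<bullet> u \<ge> 1 - t" using *[OF assms(2,3), of \<xi>] assms(1) by (auto simp: inner_simps norm_eq_1)
qed

lemma dist_unit_vectors_le:
  assumes "norm \<xi> = 1" "norm \<eta> = 1" "\<xi> \<bullet> \<eta> \<ge> 1 - t"
  shows "(dist \<xi> \<eta>)\<^sup>2 \<le> 2 * t"
proof -
  have "(dist \<xi> \<eta>)\<^sup>2 = (\<xi> - \<eta>) \<bullet> (\<xi> - \<eta>)" by (simp add: dist_norm power2_norm_eq_inner)
  also have "\<dots> = \<xi> \<bullet> \<xi> + \<eta> \<bullet> \<eta> - 2 * (\<xi> \<bullet> \<eta>)" by (simp add: inner_simps inner_commute)
  also have "\<dots> \<le> 2 * t" using assms by (simp add: norm_eq_1)
  finally show ?thesis .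
qed

text \<open>
  The cap of height \<open>t\<close> of the unit ball contains a cylinder of radius of order \<open>\<surd>t\<close> and thickness of
  order \<open>t\<close>.
\<close>

lemma slab_in_unit_ball_cap:
  assumes "norm \<xi> = 1" "\<xi> \<bullet> \<tau> = 0" "(norm \<tau>)\<^sup>2 \<le> t / 4" "0 \<le> s" "s \<le> t / 4" "t \<le> 1"
  shows "norm ((1 - t / 2 + s) *\<^sub>R \<xi> + \<tau>) \<le> 1" "\<xi> \<bullet> ((1 - t / 2 + s) *\<^sub>R \<xi> + \<tau>) = 1 - t / 2 + s"
proof -
  let ?v = "(1 - t / 2 + s) *\<^sub>R \<xi> + \<tau>"
  have \<xi>: "\<xi> \<bullet> \<xi> = 1" using assms(1) by (simp add: norm_eq_1)
  show "\<xi> \<bullet> ?v = 1 - t / 2 + s" using \<xi> assms(2) by (simp add: inner_simps)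
  have "(norm ?v)\<^sup>2 = (1 - t / 2 + s)\<^sup>2 + (norm \<tau>)\<^sup>2"
    unfolding power2_norm_eq_inner
    using \<xi> assms(2) by (simp add: inner_add_left inner_add_right inner_commute power2_eq_square)
  also have "\<dots> \<le> (1 - t / 4)\<^sup>2 + t / 4"
    using assms by (intro add_mono power_mono) auto
  also have "\<dots> = 1 - t / 4 + t * t / 16" by (simp add: power2_eq_square field_simps)
  also have "\<dots> \<le> 1"
  proof -
    have "t \<ge> 0" using assms by simp
    then have "t * t \<le> t * 1" using assms by (intro mult_left_mono) auto
    then show ?thesis using \<open>t \<ge> 0\<close> by simp
  qed
  finally show "norm ?v \<le> 1" using power2_le_imp_le[of "norm ?v" 1] by simp
qed

text \<open>
  The differences of points of two caps, perturbed by \<open>e\<close>, are covered by a few translates of the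
  difference body of one cap of the rounded sum: interchanging the \<open>B\<close>-components turns a
  difference of \<open>x\<close> and \<open>y\<close> into a difference of two sums. Rounding the \<open>\<xi>\<close>-coordinate
  of \<open>e\<close> down to a multiple of \<open>t / 4\<close> selects the translate, and the rest of \<open>e\<close> is put into the
  ball component.
\<close>

lemma difference_near_translated_cap_diff:
  assumes \<xi>: "norm \<xi> = 1" and x: "x \<in> cap A \<xi> t" and y: "y \<in> cap B \<xi> t"
    and x0: "x0 \<in> cap A \<xi> 0" and y0: "y0 \<in> cap B \<xi> 0"
    and t: "0 < t" "t \<le> 1" and \<epsilon>: "\<epsilon>\<^sup>2 \<le> t / 4" "norm e \<le> \<epsilon>"
  obtains k :: int where "\<bar>real_of_int k\<bar> \<le> 4 * \<epsilon> / t + 1"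
    "x - y + e \<in> (\<lambda>z. (x0 - y0 + (real_of_int k * (t / 4)) *\<^sub>R \<xi>) + z) ` cap_diff (rounded_sum A B) \<xi> (2 * t)"
proof -
  define s where "s = \<xi> \<bullet> e"
  define \<tau> where "\<tau> = e - s *\<^sub>R \<xi>"
  have \<xi>\<xi>: "\<xi> \<bullet> \<xi> = 1" using \<xi> by (simp add: norm_eq_1)
  have orth: "\<xi> \<bullet> \<tau> = 0" using \<xi>\<xi> by (simp add: \<tau>_def s_def inner_simps)
  have "(norm e)\<^sup>2 = s\<^sup>2 + (norm \<tau>)\<^sup>2"
    unfolding power2_norm_eq_inner \<tau>_def s_def using \<xi>\<xi>
    by (simp add: inner_simps inner_commute power2_eq_square)
  then have "(norm \<tau>)\<^sup>2 \<le> (norm e)\<^sup>2" by simp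
  also have "\<dots> \<le> \<epsilon>\<^sup>2" using \<epsilon>(2) by (intro power_mono) auto
  finally have \<tau>: "(norm \<tau>)\<^sup>2 \<le> t / 4" using \<epsilon> by simp
  have s: "\<bar>s\<bar> \<le> \<epsilon>" using Cauchy_Schwarz_ineq2[of \<xi> e] \<xi> \<epsilon>(2) by (simp add: s_def)
  define k where "k = \<lfloor>s / (t / 4)\<rfloor>"
  define s' where "s' = s - real_of_int k * (t / 4)"
  have k: "real_of_int k \<le> s / (t / 4)" "s / (t / 4) < real_of_int k + 1" by (auto simp: k_def)
  have "real_of_int k * (t / 4) \<le> s" using k(1) t by (simp only: pos_le_divide_eq)
  moreover have "s < (real_of_int k + 1) * (t / 4)" using k(2) t by (simp only: pos_divide_less_eq)
  ultimately have s': "0 \<le> s'" "s' \<le> t / 4" by (auto simp: s'_def distrib_right)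
  have "\<bar>s / (t / 4)\<bar> \<le> 4 * \<epsilon> / t" using s t by (simp add: abs_mult divide_right_mono)
  then have k_bound: "\<bar>real_of_int k\<bar> \<le> 4 * \<epsilon> / t + 1" using k by linarith
  define u where "u = (1 - t / 2 + s') *\<^sub>R \<xi> + \<tau>"
  define u0 where "u0 = (1 - t / 2 + 0) *\<^sub>R \<xi> + 0"
  have u: "norm u \<le> 1" "\<xi> \<bullet> u \<ge> 1 - t / 2"
    using slab_in_unit_ball_cap[OF \<xi> orth \<tau> s' t(2)] s' by (auto simp: u_def)
  have u0: "norm u0 \<le> 1" "\<xi> \<bullet> u0 \<ge> 1 - t / 2"
    using slab_in_unit_ball_cap[OF \<xi>, of 0 t 0] t by (auto simp: u0_def)
  have "x + y0 + u \<in> cap (rounded_sum A B) \<xi> (t + 0 + t / 2)"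
    "x0 + y + u0 \<in> cap (rounded_sum A B) \<xi> (0 + t + t / 2)"
    by (intro cap_rounded_sumI \<xi> x y x0 y0 u u0)+
  then have "x + y0 + u \<in> cap (rounded_sum A B) \<xi> (2 * t)" "x0 + y + u0 \<in> cap (rounded_sum A B) \<xi> (2 * t)"
    using t by (auto elim!: subsetD[OF cap_mono, rotated])
  then have "(x + y0 + u) - (x0 + y + u0) \<in> cap_diff (rounded_sum A B) \<xi> (2 * t)"
    unfolding cap_diff_def by blast
  moreover have "x - y + e = (x0 - y0 + (real_of_int k * (t / 4)) *\<^sub>R \<xi>) + ((x + y0 + u) - (x0 + y + u0))"
    by (simp add: u_def u0_def \<tau>_def s'_def algebra_simps)
  ultimately show ?thesis using that k_bound by blast
qed

lemma measure_lebesgue_Times: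
  fixes S :: "'a::euclidean_space set" and T :: "'b::euclidean_space set"
  assumes "S \<in> sets borel" "T \<in> sets borel"
  shows "measure lebesgue (S \<times> T) = measure lebesgue S * measure lebesgue T"
proof -
  have "S \<times> T \<in> sets borel" using assms by (rule borel_Times)
  moreover have "emeasure lborel (S \<times> T) = emeasure lborel S * emeasure lborel T"
    unfolding lborel_prod[symmetric] using assms by (intro lborel.emeasure_pair_measure_Times) auto
  ultimately show ?thesis
    using assms by (simp add: measure_def enn2real_mult)
qed

section \<open>The volume of neighbourhoods\<close>

text \<open>
  The constants: \<open>h = \<epsilon>\<^sup>2\<close>, and \<open>t = 6 d h\<close> is the height provided by the covering theorem,
  assumed to be at most \<open>1\<close>. Normals
  are determined up to \<open>\<surd>(2 t) \<le> 4 d \<epsilon>\<close>, which becomes \<open>5 d \<epsilon>\<close> after a displacement by \<open>\<epsilon>\<close>;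
  between \<open>-n\<close> and \<open>n\<close> there are at most \<open>7 / \<epsilon>\<close> integers.
\<close>

lemma neighbourhood_of_common_normals_measure_le:
  fixes A B :: "'a::euclidean_space set"
  assumes A: "compact A" "convex A" "A \<noteq> {}" and B: "compact B" "convex B" "B \<noteq> {}"
    and S: "\<And>z \<eta>. (z, \<eta>) \<in> S \<Longrightarrow> \<exists>x y. z = x - y \<and> norm \<eta> = 1 \<and> x \<in> cap A \<eta> 0 \<and> y \<in> cap B \<eta> 0"
  defines "d \<equiv> real DIM('a)"
  obtains C where "C \<ge> 0" "\<And>\<epsilon> N. 0 < \<epsilon> \<Longrightarrow> 6 * d * \<epsilon>\<^sup>2 \<le> 1 \<Longrightarrow> (\<And>z. z \<in> N \<Longrightarrow> \<exists>s\<in>S. dist z s \<le> \<epsilon>)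
     \<Longrightarrow> emeasure lebesgue N \<le> ennreal (C * \<epsilon> ^ (DIM('a) + 1))"
proof -
  have d: "d \<ge> 1" using real_DIM_ge_1 by (simp add: d_def)
  define K where "K = rounded_sum A B"
  have K: "compact K" "convex K"
    unfolding K_def by (intro compact_rounded_sum convex_rounded_sum A B)+
  obtain a b where ab: "a \<in> A" "b \<in> B" using A B by blast
  have ball: "cball (a + b) 1 \<subseteq> K"
  proof
    fix v assume "v \<in> cball (a + b) 1"
    then have "norm (v - (a + b)) \<le> 1" by (simp add: dist_norm norm_minus_commute)
    then show "v \<in> K" unfolding K_def rounded_sum_def using ab
      by (intro image_eqI[of _ _ "(a, b, v - (a + b))"]) auto
  qed
  have "\<exists>w. w \<in> cap A \<xi> 0" "\<exists>w. w \<in> cap B \<xi> 0" for \<xi>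
    by (intro cap_top_nonempty A B)+
  then obtain x0 y0 where x0: "\<And>\<xi>. x0 \<xi> \<in> cap A \<xi> 0" and y0: "\<And>\<xi>. y0 \<xi> \<in> cap B \<xi> 0" by metis
  define \<omega> where "\<omega> = unit_ball_vol d"
  have \<omega>: "\<omega> \<ge> 0" using d by (simp add: \<omega>_def)
  define C where "C = 7 * (\<omega> * (5 * d) ^ DIM('a)) * ((4 * d * (12 * d)) ^ DIM('a) * (3 * d * measure lebesgue K))"
  have "emeasure lebesgue N \<le> ennreal (C * \<epsilon> ^ (DIM('a) + 1))"
    if \<epsilon>: "0 < \<epsilon>" "6 * d * \<epsilon>\<^sup>2 \<le> 1" and N: "\<And>z. z \<in> N \<Longrightarrow> \<exists>s\<in>S. dist z s \<le> \<epsilon>" for \<epsilon> N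
  proof -
    define h where "h = \<epsilon>\<^sup>2"
    define t where "t = 6 * d * h"
    have "h \<le> d * h" using mult_right_mono[of 1 d h] d by (simp add: h_def)
    moreover have "h > 0" "6 * (d * h) \<le> 1" using \<epsilon> by (simp_all add: h_def mult.assoc)
    ultimately have h: "0 < h" "3 * h \<le> 1" "0 < t" "t \<le> 1" "h \<le> t / 4"
      unfolding t_def mult.assoc by linarith+
    have "\<epsilon>\<^sup>2 \<le> 1\<^sup>2" using h unfolding h_def by simp
    then have \<epsilon>1: "\<epsilon> \<le> 1" by (rule power2_le_imp_le) simp
    from economic_cap_covering[OF K ball h(1,2)] obtain I where I: "finite I" "I \<subseteq> sphere 0 1"
      "\<And>\<eta>. norm \<eta> = 1 \<Longrightarrow> \<exists>\<xi>\<in>I. cap K \<eta> h \<subseteq> cap K \<xi> t"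
      "\<And>s. s \<ge> 1 \<Longrightarrow> (\<Sum>\<xi>\<in>I. measure lebesgue (cap_diff K \<xi> (s * h)))
       \<le> (4 * d * s) ^ DIM('a) * (3 * d * h * measure lebesgue K)"
      unfolding d_def t_def by blast
    define n where "n = \<lceil>1 / \<epsilon>\<rceil> + 1"
    define T where "T \<xi> k = (\<lambda>z. (x0 \<xi> - y0 \<xi> + (real_of_int k * (t / 4)) *\<^sub>R \<xi>) + z) ` cap_diff K \<xi> (2 * t)" for \<xi> k
    define U where "U = (\<Union>\<xi>\<in>I. \<Union>k\<in>{-n..n}. T \<xi> k \<times> cball \<xi> (5 * d * \<epsilon>))"
    have T: "compact (T \<xi> k)" "measure lebesgue (T \<xi> k) = measure lebesgue (cap_diff K \<xi> (2 * t))" for \<xi> k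
      unfolding T_def by (rule compact_translation[OF compact_cap_diff[OF K(1)]], rule measure_translation)
    have "N \<subseteq> U"
    proof
      fix z' assume "z' \<in> N"
      obtain z1 \<eta>1 where z': "z' = (z1, \<eta>1)" by (cases z')
      obtain z \<eta> where z: "(z, \<eta>) \<in> S" "dist (z1, \<eta>1) (z, \<eta>) \<le> \<epsilon>" using N \<open>z' \<in> N\<close> z' by fast
      have near: "norm (z1 - z) \<le> \<epsilon>" "dist \<eta> \<eta>1 \<le> \<epsilon>"
        using dist_fst_le[of "(z1, \<eta>1)" "(z, \<eta>)"] dist_snd_le[of "(z1, \<eta>1)" "(z, \<eta>)"] z(2)
        by (auto simp: dist_norm norm_minus_commute)
      obtain x y where xy: "z = x - y" "norm \<eta> = 1" "x \<in> cap A \<eta> 0" "y \<in> cap B \<eta> 0" using S[OF z(1)] by blast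
      obtain \<xi> where \<xi>: "\<xi> \<in> I" "cap K \<eta> h \<subseteq> cap K \<xi> t" using I(3)[OF xy(2)] by blast
      have \<xi>1: "norm \<xi> = 1" using \<xi> I by auto
      have "x + y + \<eta> \<in> cap K \<eta> (0 + 0 + h)"
        unfolding K_def by (rule cap_rounded_sumI) (use xy h norm_eq_1[of \<eta>] in auto)
      then have "x + y + \<eta> \<in> cap (rounded_sum A B) \<xi> t" using \<xi> K_def by auto
      then have caps: "x \<in> cap A \<xi> t" "y \<in> cap B \<xi> t" "\<xi> \<bullet> \<eta> \<ge> 1 - t"
        using cap_rounded_sumD[OF \<xi>1 capD(1)[OF xy(3)] capD(1)[OF xy(4)], of \<eta> t] xy(2) by auto
      have "(dist \<xi> \<eta>)\<^sup>2 \<le> 2 * t" by (rule dist_unit_vectors_le[OF \<xi>1 xy(2) caps(3)])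
      also have "\<dots> = 12 * d * h" by (simp add: t_def)
      also have "\<dots> \<le> 16 * (d * d) * h"
      proof (rule mult_right_mono)
        show "12 * d \<le> 16 * (d * d)" using mult_left_mono[of 1 d d] d by simp
      qed (use h in simp)
      also have "\<dots> = (4 * d * \<epsilon>)\<^sup>2" by (simp add: h_def power2_eq_square)
      finally have "dist \<xi> \<eta> \<le> 4 * d * \<epsilon>" by (rule power2_le_imp_le) (use d \<epsilon> in simp)
      moreover have "\<epsilon> \<le> d * \<epsilon>" using mult_right_mono[of 1 d \<epsilon>] d \<epsilon> by simp
      ultimately have "dist \<xi> \<eta>1 \<le> 5 * d * \<epsilon>"
        using dist_triangle[of \<xi> \<eta>1 \<eta>] near(2) unfolding mult.assoc by linarith
      obtain k where k: "\<bar>real_of_int k\<bar> \<le> 4 * \<epsilon> / t + 1" "x - y + (z1 - z) \<in> T \<xi> k"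
        unfolding T_def K_def
        by (rule difference_near_translated_cap_diff[OF \<xi>1 caps(1,2) x0 y0 h(3,4) h(5)[unfolded h_def] near(1)])
      have "4 * \<epsilon> / t = (4 / (6 * d)) * (1 / \<epsilon>)" using d \<epsilon> by (simp add: t_def h_def power2_eq_square)
      also have "\<dots> \<le> 1 * (1 / \<epsilon>)" using d \<epsilon> by (intro mult_right_mono) auto
      finally have "\<bar>real_of_int k\<bar> \<le> 1 / \<epsilon> + 1" using k by simp
      then have "k \<in> {-n..n}" unfolding n_def by (simp, linarith)
      moreover have "z1 \<in> T \<xi> k" using k xy by simp
      ultimately show "z' \<in> U"
        using \<open>dist \<xi> \<eta>1 \<le> 5 * d * \<epsilon>\<close> unfolding U_def z'
        by (intro UN_I[OF \<xi>(1)] UN_I[of k]) auto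
    qed
    have "compact U"
      unfolding U_def using I(1) T(1) by (intro compact_UN compact_Times) auto
    define m where "m \<xi> = measure lebesgue (cap_diff K \<xi> (2 * t))" for \<xi>
    define \<beta> where "\<beta> = \<omega> * (5 * d * \<epsilon>) ^ DIM('a)"
    have \<beta>: "measure lebesgue (cball \<xi> (5 * d * \<epsilon>)) = \<beta>" for \<xi> :: 'a
      using content_cball[of "5 * d * \<epsilon>" \<xi>] d \<epsilon> by (simp add: \<beta>_def \<omega>_def d_def)
    have \<beta>0: "\<beta> \<ge> 0" unfolding \<beta>[symmetric, of 0] by simp
    have pieces: "measure lebesgue (T \<xi> k \<times> cball \<xi> (5 * d * \<epsilon>)) = m \<xi> * \<beta>" for \<xi> k
      using T(1)[of \<xi> k] by (subst measure_lebesgue_Times) (auto simp: T(2) \<beta> m_def borel_compact)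
    have pieces_sets: "T \<xi> k \<times> cball \<xi> (5 * d * \<epsilon>) \<in> sets lebesgue" for \<xi> k
      by (intro fmeasurableD lmeasurable_compact compact_Times T) auto
    have "1 / \<epsilon> \<ge> 1" using \<epsilon> \<epsilon>1 by simp
    moreover have "n \<ge> 0 \<and> 2 * real_of_int n + 1 \<le> 7 * q" if "1 \<le> q" "n = \<lceil>q\<rceil> + 1" for q :: real
      using that by linarith
    ultimately have n: "n \<ge> 0" "2 * real_of_int n + 1 \<le> 7 * (1 / \<epsilon>)"
      using n_def by blast+
    have "measure lebesgue U \<le> (\<Sum>\<xi>\<in>I. \<Sum>k\<in>{-n..n}. m \<xi> * \<beta>)"
    proof -
      have "measure lebesgue U \<le> (\<Sum>\<xi>\<in>I. measure lebesgue (\<Union>k\<in>{-n..n}. T \<xi> k \<times> cball \<xi> (5 * d * \<epsilon>)))"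
        unfolding U_def using pieces_sets I(1) by (intro measure_UNION_le sets.finite_UN) auto
      also have "\<dots> \<le> (\<Sum>\<xi>\<in>I. \<Sum>k\<in>{-n..n}. m \<xi> * \<beta>)"
      proof (rule sum_mono)
        fix \<xi>
        have "measure lebesgue (\<Union>k\<in>{-n..n}. T \<xi> k \<times> cball \<xi> (5 * d * \<epsilon>))
            \<le> (\<Sum>k\<in>{-n..n}. measure lebesgue (T \<xi> k \<times> cball \<xi> (5 * d * \<epsilon>)))"
          by (intro measure_UNION_le pieces_sets) simp
        then show "measure lebesgue (\<Union>k\<in>{-n..n}. T \<xi> k \<times> cball \<xi> (5 * d * \<epsilon>))
            \<le> (\<Sum>k\<in>{-n..n}. m \<xi> * \<beta>)" unfolding pieces .
      qed
      finally show ?thesis .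
    qed
    also have "\<dots> = (2 * real_of_int n + 1) * \<beta> * sum m I"
      unfolding sum_distrib_left using n by (intro sum.cong) (simp_all add: mult_ac)
    also have "\<dots> \<le> (7 * (1 / \<epsilon>)) * \<beta> * ((4 * d * (12 * d)) ^ DIM('a) * (3 * d * h * measure lebesgue K))"
    proof (intro mult_mono n order.refl \<beta>0)
      show "sum m I \<le> (4 * d * (12 * d)) ^ DIM('a) * (3 * d * h * measure lebesgue K)"
        using I(4)[of "12 * d"] d unfolding m_def t_def by (simp add: mult.assoc mult.left_commute)
    qed (use \<beta>0 \<epsilon> d in \<open>auto simp: m_def intro!: sum_nonneg mult_nonneg_nonneg\<close>)
    also have "\<dots> = C * ((1 / \<epsilon>) * \<epsilon> ^ DIM('a) * h)"
      unfolding C_def \<beta>_def power_mult_distrib by (simp add: mult_ac)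
    also have "(1 / \<epsilon>) * \<epsilon> ^ DIM('a) * h = \<epsilon> ^ (DIM('a) + 1)"
      using \<epsilon> by (simp add: h_def power2_eq_square)
    finally have "measure lebesgue U \<le> C * \<epsilon> ^ (DIM('a) + 1)" .
    moreover have "emeasure lebesgue N \<le> emeasure lebesgue U"
      using \<open>N \<subseteq> U\<close> \<open>compact U\<close> by (intro emeasure_mono fmeasurableD lmeasurable_compact)
    moreover have "emeasure lebesgue U = ennreal (measure lebesgue U)"
      using \<open>compact U\<close> by (intro emeasure_eq_measure2 lmeasurable_compact)
    ultimately show ?thesis using ennreal_leI order_trans by fastforce
  qed
  moreover have "C \<ge> 0" using d \<omega> by (auto simp: C_def intro!: mult_nonneg_nonneg)
  ultimately show ?thesis using that by blast
qed

theorem lemma3p2: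
  fixes A B :: "(real ^ 'd) set"
  assumes "compact A" and "convex A" and "compact B" and "convex B"
  shows "finite_content (CARD('d) - 1) (Sigma_nor A B)"
proof (cases "Sigma_nor A B = {}")
  case True
  then have "parallel_set (Sigma_nor A B) \<epsilon> = {}" for \<epsilon> by (simp add: parallel_set_def)
  then show ?thesis by (simp add: finite_content_def upper_content_def Limsup_const)
next
  case False
  define d where "d = CARD('d)"
  have d: "real d \<ge> 1" unfolding d_def by (simp add: Suc_leI)
  have DIM: "DIM(real ^ 'd) = d" "DIM((real ^ 'd) \<times> (real ^ 'd)) = 2 * d" by (simp_all add: d_def)
  have normals: "\<exists>x y. z = x - y \<and> norm \<eta> = 1 \<and> x \<in> cap A \<eta> 0 \<and> y \<in> cap B \<eta> 0"
    if "(z, \<eta>) \<in> Sigma_nor A B" for z \<eta>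
    using that nor_imp_cap[OF compact_imp_closed[OF assms(1)]] nor_imp_cap[OF compact_imp_closed[OF assms(3)]]
    unfolding Sigma_nor_def by blast
  have nonempty: "A \<noteq> {}" "B \<noteq> {}" using False by (auto simp: Sigma_nor_def)
  obtain C where C: "C \<ge> 0" "\<And>\<epsilon> N. 0 < \<epsilon> \<Longrightarrow> 6 * real d * \<epsilon>\<^sup>2 \<le> 1
      \<Longrightarrow> (\<And>z. z \<in> N \<Longrightarrow> \<exists>s\<in>Sigma_nor A B. dist z s \<le> \<epsilon>) \<Longrightarrow> emeasure lebesgue N \<le> ennreal (C * \<epsilon> ^ (d + 1))"
    using neighbourhood_of_common_normals_measure_le[OF assms(1,2) nonempty(1) assms(3,4) nonempty(2) normals]
    unfolding DIM by blast
  have bound: "ennreal ((2 * \<epsilon>) powr (real (d - 1) - real (2 * d))) *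
      emeasure lebesgue (parallel_set (Sigma_nor A B) \<epsilon>) \<le> ennreal C"
    if \<epsilon>: "0 < \<epsilon>" "\<epsilon> < 1 / (24 * real d)" for \<epsilon>
  proof -
    have small: "24 * real d * \<epsilon> \<le> 1" using \<epsilon> d by (simp add: pos_less_divide_eq mult.commute)
    moreover have "1 * \<epsilon> \<le> 24 * real d * \<epsilon>" using \<epsilon> d by (intro mult_right_mono) auto
    ultimately have "\<epsilon> \<le> 1" by linarith
    then have "(24 * real d * \<epsilon>) * \<epsilon> \<le> 1 * 1" using \<epsilon> small by (intro mult_mono) auto
    then have "6 * real d * (2 * \<epsilon>)\<^sup>2 \<le> 1" by (simp add: power2_eq_square mult_ac)
    moreover have "\<exists>s\<in>Sigma_nor A B. dist z s \<le> 2 * \<epsilon>" if "z \<in> parallel_set (Sigma_nor A B) \<epsilon>" for z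
    proof -
      (* the factor 2 provides a point of the set without its being closed *)
      have "infdist z (Sigma_nor A B) < 2 * \<epsilon>" using that \<epsilon> by (simp add: parallel_set_def)
      then obtain s where "s \<in> Sigma_nor A B" "dist z s < 2 * \<epsilon>" using False
        by (auto simp: infdist_def cINF_less_iff)
      then show ?thesis by force
    qed
    ultimately have "emeasure lebesgue (parallel_set (Sigma_nor A B) \<epsilon>) \<le> ennreal (C * (2 * \<epsilon>) ^ (d + 1))"
      using \<epsilon> by (intro C(2)) auto
    then have "ennreal ((2 * \<epsilon>) powr (real (d - 1) - real (2 * d))) * emeasure lebesgue (parallel_set (Sigma_nor A B) \<epsilon>)
       \<le> ennreal ((2 * \<epsilon>) powr (real (d - 1) - real (2 * d))) * ennreal (C * (2 * \<epsilon>) ^ (d + 1))"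
      by (rule mult_left_mono) simp
    also have "\<dots> = ennreal ((2 * \<epsilon>) powr (real (d - 1) - real (2 * d)) * (C * (2 * \<epsilon>) ^ (d + 1)))"
      by (rule ennreal_mult'[symmetric]) simp
    also have "(2 * \<epsilon>) powr (real (d - 1) - real (2 * d)) * (C * (2 * \<epsilon>) ^ (d + 1)) = C"
    proof -
      define e where "e = d + 1"
      have "real (d - 1) - real (2 * d) = - real e" using d by (simp add: e_def of_nat_diff)
      moreover have "(2 * \<epsilon>) powr (- real e) = inverse ((2 * \<epsilon>) ^ e)"
        using \<epsilon> by (simp add: powr_minus powr_realpow)
      moreover have "inverse P * (C * P) = C" if "P \<noteq> 0" for P using that by simp
      then have "inverse ((2 * \<epsilon>) ^ e) * (C * (2 * \<epsilon>) ^ e) = C" using \<epsilon> by (metis mult_eq_0_iff power_eq_0_iff less_irrefl zero_neq_numeral)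
      ultimately show ?thesis unfolding e_def[symmetric] by (simp only:)
    qed
    finally show ?thesis .
  qed
  have "\<forall>\<^sub>F \<epsilon> in at_right 0. \<epsilon> < 1 / (24 * real d)"
    using d by (intro order_tendstoD(2)[OF tendsto_ident_at]) simp
  moreover have "\<forall>\<^sub>F \<epsilon> in at_right 0. 0 < (\<epsilon>::real)" by (rule eventually_at_right_less)
  ultimately have "\<forall>\<^sub>F \<epsilon> in at_right 0. ennreal ((2 * \<epsilon>) powr (real (d - 1) - real (2 * d))) *
      emeasure lebesgue (parallel_set (Sigma_nor A B) \<epsilon>) \<le> ennreal C"
    by eventually_elim (rule bound)
  then have "upper_content (d - 1) (Sigma_nor A B) \<le> ennreal C"
    unfolding upper_content_def DIM by (rule Limsup_bounded)
  then show ?thesis unfolding finite_content_def d_def[symmetric]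
    using ennreal_less_top[of C] by (auto simp: less_top[symmetric] top_unique)
qed

end
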